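(* Let $\mathtt{k}>0$, $a\in\mathbb{R}$ and $\nu>|a|-\mathtt{k}$. Then for every $x>0$, $$\left(\mathcal{I}^{\mathtt{k}}_{\nu}(x)\right)^2-\mathcal{I}^{\mathtt{k}}_{\nu-a}(x)\,\mathcal{I}^{\mathtt{k}}_{\nu+a}(x)\ \le\ 0.$$
   Context: For $\mathtt{k}>0$, the $\mathtt{k}$-gamma function is $\Gamma_{\mathtt{k}}(z)=\int_0^\infty t^{z-1}e^{-t^{\mathtt{k}}/\mathtt{k}}\,dt$ for $\operatorname{Re}(z)>0$; it satisfies $\Gamma_{\mathtt{k}}(z+\mathtt{k})=z\,\Gamma_{\mathtt{k}}(z)$. For $\nu>-\mathtt{k}$ the modified $\mathtt{k}$-Bessel function is $$\mathtt{I}^{\mathtt{k}}_{\nu}(x)=\sum_{r=0}^\infty\frac{1}{\Gamma_{\mathtt{k}}(r\mathtt{k}+\nu+\mathtt{k})\,r!}\left(\frac{x}{2}\right)^{2r+\frac{\nu}{\mathtt{k}}},$$ and its normalized form is $$\mathcal{I}^{\mathtt{k}}_{\nu}(x)=\left(\frac{2}{x}\right)^{\frac{\nu}{\mathtt{k}}}\Gamma_{\mathtt{k}}(\nu+\mathtt{k})\,\mathtt{I}^{\mathtt{k}}_{\nu}(x)=\sum_{r=0}^\infty\frac{\Gamma_{\mathtt{k}}(\nu+\mathtt{k})}{\Gamma_{\mathtt{k}}(r\mathtt{k}+\nu+\mathtt{k})\,4^r\,r!}\,x^{2r}.$$ *)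

theory Defs
  imports "HOL-Analysis.Analysis"
begin

(* Polymorphic so that one definition covers both the real and the complex argument;
   the integral is meaningful for k > 0 and Re z > 0.  The endpoint t = 0 is immaterial. *)
definition k_Gamma :: "real \<Rightarrow> 'a::{ln,banach,real_normed_field} \<Rightarrow> 'a" where
  "k_Gamma k z =
     integral {0<..} (\<lambda>t. of_real t powr (z - 1) * of_real (exp (- (t powr k) / k)))"

definition k_Bessel_I :: "real \<Rightarrow> real \<Rightarrow> real \<Rightarrow> real" where
  "k_Bessel_I k \<nu> x =
     (\<Sum>r. 1 / (k_Gamma k (real r * k + \<nu> + k) * fact r) * (x / 2) powr (2 * real r + \<nu> / k))"

(* The closed form only; for x > 0 it agrees with the power series in x^2, but not at x = 0,
   where the factor (2 / x) powr (\<nu> / k) degenerates to 0. *)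
definition normalized_k_Bessel_I :: "real \<Rightarrow> real \<Rightarrow> real \<Rightarrow> real" where
  "normalized_k_Bessel_I k \<nu> x = (2 / x) powr (\<nu> / k) * k_Gamma k (\<nu> + k) * k_Bessel_I k \<nu> x"

end

theory Submission imports Defs begin

text \<open>
  For a positive first parameter the substitution \<open>u = t powr k / k\<close> reduces the
  k-gamma function to Euler's, so that the normalized modified k-Bessel function is the
  confluent hypergeometric limit function
  \<open>0F1(; p; y) = (\<Sum>r. y^r / (r! * pochhammer p r))\<close>
  at \<open>p = \<nu>/k + 1\<close> and \<open>y = x\<^sup>2/(4 k)\<close>: see \<open>k_Gamma_eq_Gamma\<close> and
  \<open>normalized_k_Bessel_I_eq_0F1\<close>.  The order \<open>\<nu>\<close> now enters only through the Pochhammer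
  symbols, and the claim becomes midpoint log-convexity of \<open>0F1\<close> in \<open>p\<close>.

  Each coefficient is already log-convex in \<open>p\<close>, since a Pochhammer symbol is a product of
  factors \<open>p + j\<close> and \<open>(p - b + j) * (p + b + j) \<le> (p + j)\<^sup>2\<close>
  (\<open>pochhammer_log_concave\<close>).  The Cauchy-Schwarz inequality passes this
  from the coefficients to the sum (\<open>suminf_square_le_mult\<close>).
\<close>

lemma k_Gamma_eq_Gamma:
  fixes k z :: real
  assumes "k > 0" "z > 0"
  shows "k_Gamma k z = k powr (z / k - 1) * Gamma (z / k)"
proof -
  define f :: "real \<Rightarrow> real" where "f u = u powr (z / k - 1) / exp u" for u
  define g where "g t = t powr k / k" for t :: real
  have image: "g ` {0<..} = {0<..}"
  proof (intro equalityI subsetI)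
    fix u :: real assume u: "u \<in> {0<..}"
    then have "g ((k * u) powr (1 / k)) = u"
      using assms by (simp add: g_def powr_powr)
    moreover have "(k * u) powr (1 / k) \<in> {0<..}"
      using u assms by simp
    ultimately show "u \<in> g ` {0<..}" by (metis imageI)
  qed (use assms in \<open>auto simp: g_def\<close>)
  have "(f has_integral Gamma (z / k)) {0..}"
    unfolding f_def using Gamma_integral_real[of "z / k"] assms by simp
  then have int: "(f has_integral Gamma (z / k)) {0<..}"
    by (rule has_integral_spike_set_eq[THEN iffD1, rotated 2])
       (auto intro!: negligible_subset[OF negligible_sing[of 0]])
  have "f absolutely_integrable_on {0<..}"
    using int by (intro nonnegative_absolutely_integrable_1) (auto simp: f_def integrable_on_def)
  with int have "f absolutely_integrable_on (g ` {0<..}) \<and> integral (g ` {0<..}) f = Gamma (z / k)"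
    unfolding image by (auto simp: integral_unique)
  moreover have "(g has_field_derivative t powr (k - 1)) (at t within {0<..})"
    if "t \<in> {0<..}" for t
    unfolding g_def using that assms by (auto intro!: derivative_eq_intros)
  moreover have "inj_on g {0<..}"
    by (rule inj_on_inverseI[where g = "\<lambda>u. (k * u) powr (1 / k)"])
       (use assms in \<open>simp add: g_def powr_powr\<close>)
  ultimately have *: "integral {0<..} (\<lambda>t. \<bar>t powr (k - 1)\<bar> * f (g t)) = Gamma (z / k)"
    using has_absolute_integral_change_of_variables_1'
            [of "{0<..}" g "\<lambda>t. t powr (k - 1)" f "Gamma (z / k)"] by simp
  have "t powr (z - 1) * exp (- (t powr k) / k)
          = k powr (z / k - 1) * (\<bar>t powr (k - 1)\<bar> * f (g t))" if "t \<in> {0<..}" for t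
  proof -
    have "k * (z / k - 1) = z - k"
      using assms by (simp add: field_simps)
    then have "(t powr k / k) powr (z / k - 1) = t powr (z - k) / k powr (z / k - 1)"
      using assms that by (simp add: powr_divide powr_powr)
    moreover have "t powr (k - 1) * t powr (z - k) = t powr (z - 1)"
      by (simp flip: powr_add)
    ultimately show ?thesis
      using assms by (simp add: f_def g_def exp_minus field_simps)
  qed
  then have "k_Gamma k z
      = integral {0<..} (\<lambda>t. k powr (z / k - 1) * (\<bar>t powr (k - 1)\<bar> * f (g t)))"
    unfolding k_Gamma_def by (intro integral_cong) simp
  then show ?thesis
    using * by simp
qed

text \<open>
  For \<open>p > 0\<close> the Pochhammer symbol is at least \<open>p ^ r\<close>, so the exponential series at
  \<open>y / p\<close> dominates.
\<close>
lemma summable_0F1: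
  fixes p y :: real
  assumes "p > 0" "y \<ge> 0"
  shows "summable (\<lambda>r. y ^ r / (fact r * pochhammer p r))"
proof (rule summable_comparison_test')
  show "summable (\<lambda>r. (y / p) ^ r / fact r)"
    using summable_exp[of "y / p"] by (simp add: divide_inverse mult.commute)
  fix r :: nat
  have "(\<Prod>j<r. p) \<le> (\<Prod>j<r. p + real j)"
    using assms by (intro prod_mono) auto
  then have "p ^ r \<le> pochhammer p r"
    by (simp add: pochhammer_prod lessThan_atLeast0)
  then show "norm (y ^ r / (fact r * pochhammer p r)) \<le> (y / p) ^ r / fact r"
    using assms pochhammer_pos[of p r]
    by (auto simp: power_divide field_simps intro!: mult_right_mono)
qed

lemma normalized_k_Bessel_I_eq_0F1:
  fixes k \<nu> x :: real
  assumes "k > 0" "\<nu> > - k" "x > 0"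
  shows "normalized_k_Bessel_I k \<nu> x
           = (\<Sum>r. (x\<^sup>2 / (4 * k)) ^ r / (fact r * pochhammer (\<nu> / k + 1) r))"
proof -
  define p where "p = \<nu> / k + 1"
  define c where "c = (2 / x) powr (\<nu> / k) * k_Gamma k (\<nu> + k)"
  have p: "p > 0"
    using assms by (simp add: p_def field_simps)
  have G: "k_Gamma k (real r * k + \<nu> + k) = k powr (real r + \<nu> / k) * Gamma (p + real r)" for r
  proof -
    have "(real r * k + \<nu> + k) / k = p + real r"
      using assms by (simp add: p_def field_simps)
    moreover have "0 \<le> real r * k"
      using assms by simp
    then have "real r * k + \<nu> + k > 0"
      using assms by linarith
    ultimately show ?thesis
      using assms k_Gamma_eq_Gamma[of k "real r * k + \<nu> + k"]
      by (simp add: p_def algebra_simps)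
  qed
  have c: "c = (2 / x) powr (\<nu> / k) * (k powr (\<nu> / k) * Gamma p)"
    using G[of 0] by (simp add: c_def)
  have c0: "c \<noteq> 0"
    using assms Gamma_real_pos[OF p] by (auto simp: c)
  define b where "b r = 1 / (k_Gamma k (real r * k + \<nu> + k) * fact r)
                        * (x / 2) powr (2 * real r + \<nu> / k)" for r
  have summand: "c * b r = (x\<^sup>2 / (4 * k)) ^ r / (fact r * pochhammer p r)" for r
  proof -
    have "p \<notin> \<int>\<^sub>\<le>\<^sub>0"
      using p by (auto elim: nonpos_Ints_cases)
    then have poch: "Gamma (p + real r) = Gamma p * pochhammer p r"
      using Gamma_real_pos[OF p] by (simp add: pochhammer_Gamma)
    have x: "(x / 2) powr (2 * real r + \<nu> / k) = (x\<^sup>2 / 4) ^ r * (x / 2) powr (\<nu> / k)"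
    proof -
      have "(x / 2) powr (2 * real r) = (x / 2) ^ (2 * r)"
        using assms powr_realpow[of "x / 2" "2 * r"] by simp
      then show ?thesis
        by (simp add: powr_add power_mult power_divide)
    qed
    have "k powr (real r + \<nu> / k) = k ^ r * k powr (\<nu> / k)"
      using assms by (simp add: powr_add powr_realpow)
    moreover have "(2 / x) powr (\<nu> / k) * (x / 2) powr (\<nu> / k) = 1"
      using assms by (simp flip: powr_mult)
    moreover have "Gamma p > 0" "pochhammer p r > 0" "k powr (\<nu> / k) > 0"
      using p assms by (auto intro: Gamma_real_pos pochhammer_pos)
    ultimately show ?thesis
      using assms unfolding b_def c G poch x
      by (simp add: field_simps)
  qed
  have "summable (\<lambda>r. c * b r)"
    unfolding summand using p assms by (intro summable_0F1) auto
  then have "summable b"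
    using c0 by (simp add: summable_cmult_iff)
  then have "c * suminf b = (\<Sum>r. c * b r)"
    by (rule suminf_mult[symmetric])
  then show ?thesis
    unfolding summand p_def
    by (simp add: normalized_k_Bessel_I_def k_Bessel_I_def b_def[abs_def] c_def)
qed

lemma pochhammer_log_concave:
  fixes p b :: real
  assumes "p > \<bar>b\<bar>"
  shows "pochhammer (p - b) r * pochhammer (p + b) r \<le> (pochhammer p r)\<^sup>2"
proof -
  have "(\<Prod>j<r. (p - b + real j) * (p + b + real j)) \<le> (\<Prod>j<r. (p + real j)\<^sup>2)"
  proof (intro prod_mono conjI)
    fix j
    show "0 \<le> (p - b + real j) * (p + b + real j)"
      using assms by (intro mult_nonneg_nonneg) auto
    have "(p - b + real j) * (p + b + real j) = (p + real j)\<^sup>2 - b\<^sup>2"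
      by (simp add: power2_eq_square algebra_simps)
    then show "(p - b + real j) * (p + b + real j) \<le> (p + real j)\<^sup>2"
      by simp
  qed
  then show ?thesis
    by (simp add: pochhammer_prod lessThan_atLeast0 prod.distrib prod_power_distrib)
qed

text \<open>
  Cauchy-Schwarz for \<open>sqrt (g r)\<close> and \<open>sqrt (h r)\<close> on the partial sums, where
  \<open>f r \<le> sqrt (g r) * sqrt (h r)\<close>, followed by a limit.
\<close>
lemma suminf_square_le_mult:
  fixes f g h :: "nat \<Rightarrow> real"
  assumes "summable f" "summable g" "summable h"
    and nonneg: "\<And>r. 0 \<le> f r" "\<And>r. 0 \<le> g r" "\<And>r. 0 \<le> h r"
    and le: "\<And>r. (f r)\<^sup>2 \<le> g r * h r"
  shows "(suminf f)\<^sup>2 \<le> suminf g * suminf h"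
proof (rule LIMSEQ_le)
  show "(\<lambda>n. (\<Sum>r<n. f r)\<^sup>2) \<longlonglongrightarrow> (suminf f)\<^sup>2"
    using assms by (intro tendsto_power summable_LIMSEQ)
  show "(\<lambda>n. (\<Sum>r<n. g r) * (\<Sum>r<n. h r)) \<longlonglongrightarrow> suminf g * suminf h"
    using assms by (intro tendsto_mult summable_LIMSEQ)
  have "(\<Sum>r<n. f r)\<^sup>2 \<le> (\<Sum>r<n. g r) * (\<Sum>r<n. h r)" for n
  proof -
    have "f r \<le> sqrt (g r) * sqrt (h r)" for r
      using real_le_rsqrt[OF le] by (simp add: real_sqrt_mult)
    then have "(\<Sum>r<n. f r)\<^sup>2 \<le> (\<Sum>r<n. sqrt (g r) * sqrt (h r))\<^sup>2"
      by (intro power_mono sum_mono sum_nonneg nonneg)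
    also have "\<dots> \<le> (\<Sum>r<n. (sqrt (g r))\<^sup>2) * (\<Sum>r<n. (sqrt (h r))\<^sup>2)"
      by (rule Cauchy_Schwarz_ineq_sum)
    finally show ?thesis
      by (simp add: nonneg)
  qed
  then show "\<exists>N. \<forall>n\<ge>N. (\<Sum>r<n. f r)\<^sup>2 \<le> (\<Sum>r<n. g r) * (\<Sum>r<n. h r)"
    by blast
qed

theorem mainTheorem4:
  fixes k a \<nu> x :: real
  assumes "k > 0" and "\<nu> > \<bar>a\<bar> - k" and "x > 0"
  shows "(normalized_k_Bessel_I k \<nu> x)\<^sup>2
           - normalized_k_Bessel_I k (\<nu> - a) x * normalized_k_Bessel_I k (\<nu> + a) x \<le> 0"
proof -
  define p where "p = \<nu> / k + 1"
  define b where "b = a / k"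
  define y where "y = x\<^sup>2 / (4 * k)"
  define F where "F q r = y ^ r / (fact r * pochhammer q r)" for q r
  have y: "y \<ge> 0"
    using assms by (simp add: y_def)
  have pb: "p > \<bar>b\<bar>"
    using assms by (simp add: p_def b_def field_simps)
  have pos: "p > 0" "p - b > 0" "p + b > 0"
    using pb by linarith+
  have bessel: "normalized_k_Bessel_I k \<mu> x = suminf (F (\<mu> / k + 1))" if "\<mu> > - k" for \<mu>
    using normalized_k_Bessel_I_eq_0F1[of k \<mu> x] that assms by (simp add: F_def[abs_def] y_def)
  have "\<nu> > - k" "\<nu> - a > - k" "\<nu> + a > - k"
    using assms by linarith+
  moreover have "(\<nu> - a) / k + 1 = p - b" "(\<nu> + a) / k + 1 = p + b"
    by (simp_all add: p_def b_def diff_divide_distrib add_divide_distrib)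
  moreover have "(suminf (F p))\<^sup>2 \<le> suminf (F (p - b)) * suminf (F (p + b))"
  proof (rule suminf_square_le_mult)
    show "summable (F p)" "summable (F (p - b))" "summable (F (p + b))"
      unfolding F_def using pos y by (auto intro: summable_0F1)
    fix r
    have P: "pochhammer p r > 0" "pochhammer (p - b) r > 0" "pochhammer (p + b) r > 0"
      using pos by (auto intro: pochhammer_pos)
    then show "0 \<le> F p r" "0 \<le> F (p - b) r" "0 \<le> F (p + b) r"
      using y by (auto simp: F_def)
    have "(F p r)\<^sup>2 = (y ^ r / fact r)\<^sup>2 / (pochhammer p r)\<^sup>2"
      by (simp add: F_def power_divide power_mult_distrib)
    also have "\<dots> \<le> (y ^ r / fact r)\<^sup>2 / (pochhammer (p - b) r * pochhammer (p + b) r)"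
      using P pochhammer_log_concave[OF pb, of r] by (intro divide_left_mono mult_pos_pos) auto
    also have "\<dots> = F (p - b) r * F (p + b) r"
      by (simp add: F_def power2_eq_square)
    finally show "(F p r)\<^sup>2 \<le> F (p - b) r * F (p + b) r" .
  qed
  ultimately show ?thesis
    by (simp add: bessel flip: p_def)
qed

end
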